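(* Let $\mathcal{M}$ be a reduct of a distal structure. Then for every $k\ge2$ and every formula $\varphi(x_1,\ldots,x_k;z)$ in the language of $\mathcal{M}$ with $|x_1|=\cdots=|x_k|$ there is some $c=c(\varphi)$ such that $R^*_\varphi(n)\le\mathrm{twr}_{k-1}(n^c)$ for all $n$ large enough.
   Context: A structure $\mathcal{N}$ with underlying set $N$ is distal if for every formula $\varphi(x,y)$ there is a formula $\theta(x,y_1,\ldots,y_m)$ with $|y_1|=\cdots=|y_m|=|y|$ such that for every finite $B\subseteq N^{|y|}$ with $|B|\ge2$ and every $a\in N^{|x|}$ there are $b_1,\ldots,b_m\in B$ such that $\mathcal{N}\models\theta(a,b_1,\ldots,b_m)$ and for every $b\in B$ either $\theta(N,b_1,\ldots,b_m)\subseteq\varphi(N,b)$ or $\varphi(N,b)\cap\theta(N,b_1,\ldots,b_m)=\emptyset$. (Here $\psi(N,b)$ denotes the set of $a\in N^{|x|}$ with $\mathcal{N}\models\psi(a,b)$.) The tower function is defined by $\mathrm{twr}_1(n)=n$ and $\mathrm{twr}_{i+1}(n)=2^{\mathrm{twr}_i(n)}$. For a $k$-ary relation $E\subseteq X^k$ on a set $X$, a finite sequence $(a_i:1\le i\le m)$ in $X$ is $E$-indiscernible if either $E$ holds on all $k$-tuples $(a_{i_1},\ldots,a_{i_k})$ with $1\le i_1<\cdots<i_k\le m$, or $E$ fails on all such $k$-tuples. Let $M$ be the underlying set of $\mathcal{M}$. For a formula $\varphi(x_1,\ldots,x_k;z)$ with $|x_1|=\cdots=|x_k|=d$ and $b\in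 M^{|z|}$, let $R_{\varphi(x_1,\ldots,x_k;b)}(n)$ be the smallest $N\in\mathbb{N}$ such that every sequence of length $N$ of elements of $M^d$ contains a subsequence of length $n$ that is indiscernible for the $k$-ary relation on $M^d$ defined by $\varphi(x_1,\ldots,x_k;b)$. Then $R^*_\varphi(n):=\max\{R_{\varphi(x_1,\ldots,x_k;b)}(n): b\in M^{|z|}\}$. *)

theory Defs
  imports Complex_Main "HOL-Library.Sublist"
begin

section \<open>First-order languages, structures and formulas\<close>

text \<open>A symbol belongs to the language iff it is assigned an arity. Constants are function symbols
  of arity 0.\<close>

record ('f, 'r) fo_lang =
  funs :: "'f \<Rightarrow> nat option"
  rels :: "'r \<Rightarrow> nat option"

record ('a, 'f, 'r) fo_struct =
  univ :: "'a set"
  fun_of :: "'f \<Rightarrow> 'a list \<Rightarrow> 'a"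
  rel_of :: "'r \<Rightarrow> 'a list \<Rightarrow> bool"

text \<open>The set of \<open>n\<close>-tuples from the underlying set.\<close>

definition tuples :: "('a, 'f, 'r) fo_struct \<Rightarrow> nat \<Rightarrow> 'a list set" where
  "tuples M n = {as. length as = n \<and> set as \<subseteq> univ M}"

definition is_struct :: "('f, 'r) fo_lang \<Rightarrow> ('a, 'f, 'r) fo_struct \<Rightarrow> bool" where
  "is_struct L M \<longleftrightarrow> univ M \<noteq> {} \<and>
     (\<forall>f n. funs L f = Some n \<longrightarrow> (\<forall>as \<in> tuples M n. fun_of M f as \<in> univ M))"

text \<open>Variables are de Bruijn indices: \<open>Ex\<close> binds index 0 of its body.\<close>

datatype 'f tm = Var nat | App 'f "'f tm list"

datatype ('f, 'r) fm =
    Eq "'f tm" "'f tm"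
  | Rel 'r "'f tm list"
  | Neg "('f, 'r) fm"
  | Conj "('f, 'r) fm" "('f, 'r) fm"
  | Ex "('f, 'r) fm"

text \<open>\<open>formula L n \<phi>\<close>: \<open>\<phi>\<close> is a formula in the language \<open>L\<close> whose free variables are among the \<open>n\<close>
  variables with indices \<open>0, \<dots>, n - 1\<close>.\<close>

fun is_term :: "('f, 'r) fo_lang \<Rightarrow> nat \<Rightarrow> 'f tm \<Rightarrow> bool" where
  "is_term L n (Var i) \<longleftrightarrow> i < n"
| "is_term L n (App f ts) \<longleftrightarrow> funs L f = Some (length ts) \<and> (\<forall>t \<in> set ts. is_term L n t)"

fun formula :: "('f, 'r) fo_lang \<Rightarrow> nat \<Rightarrow> ('f, 'r) fm \<Rightarrow> bool" where
  "formula L n (Eq s t) \<longleftrightarrow> is_term L n s \<and> is_term L n t"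
| "formula L n (Rel r ts) \<longleftrightarrow> rels L r = Some (length ts) \<and> (\<forall>t \<in> set ts. is_term L n t)"
| "formula L n (Neg \<phi>) \<longleftrightarrow> formula L n \<phi>"
| "formula L n (Conj \<phi> \<psi>) \<longleftrightarrow> formula L n \<phi> \<and> formula L n \<psi>"
| "formula L n (Ex \<phi>) \<longleftrightarrow> formula L (Suc n) \<phi>"

fun val :: "('a, 'f, 'r) fo_struct \<Rightarrow> 'a list \<Rightarrow> 'f tm \<Rightarrow> 'a" where
  "val M as (Var i) = as ! i"
| "val M as (App f ts) = fun_of M f (map (val M as) ts)"

text \<open>The list \<open>as\<close> assigns \<open>as ! i\<close> to the variable with index \<open>i\<close>.\<close>

fun sat :: "('a, 'f, 'r) fo_struct \<Rightarrow> 'a list \<Rightarrow> ('f, 'r) fm \<Rightarrow> bool" where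
  "sat M as (Eq s t) \<longleftrightarrow> val M as s = val M as t"
| "sat M as (Rel r ts) \<longleftrightarrow> rel_of M r (map (val M as) ts)"
| "sat M as (Neg \<phi>) \<longleftrightarrow> \<not> sat M as \<phi>"
| "sat M as (Conj \<phi> \<psi>) \<longleftrightarrow> sat M as \<phi> \<and> sat M as \<psi>"
| "sat M as (Ex \<phi>) \<longleftrightarrow> (\<exists>x \<in> univ M. sat M (x # as) \<phi>)"

text \<open>The \<open>L\<close>-structure \<open>M\<close> is a reduct of the \<open>L'\<close>-structure \<open>N\<close>: \<open>L\<close> is a sublanguage of \<open>L'\<close>, the
  underlying sets coincide, and so do the interpretations of the symbols of \<open>L\<close>.\<close>

definition reduct :: "('f, 'r) fo_lang \<Rightarrow> ('a, 'f, 'r) fo_struct \<Rightarrow>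
    ('f, 'r) fo_lang \<Rightarrow> ('a, 'f, 'r) fo_struct \<Rightarrow> bool" where
  "reduct L M L' N \<longleftrightarrow> is_struct L M \<and> is_struct L' N \<and>
     funs L \<subseteq>\<^sub>m funs L' \<and> rels L \<subseteq>\<^sub>m rels L' \<and> univ M = univ N \<and>
     (\<forall>f n. funs L f = Some n \<longrightarrow> (\<forall>as \<in> tuples M n. fun_of M f as = fun_of N f as)) \<and>
     (\<forall>r n. rels L r = Some n \<longrightarrow> (\<forall>as \<in> tuples M n. rel_of M r as \<longleftrightarrow> rel_of N r as))"


section \<open>Distality\<close>

text \<open>A formula \<open>\<psi>(x, y)\<close> with \<open>|x| = p\<close> and \<open>|y| = q\<close> is a formula in \<open>p + q\<close> variables, the first
  \<open>p\<close> of which form \<open>x\<close>; likewise a formula \<open>\<theta>(x, y\<^sub>1, \<dots>, y\<^sub>m)\<close> has its variables in this order.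
  \<open>defset N p \<psi> b\<close> is the set \<open>\<psi>(N, b)\<close>.\<close>

definition defset :: "('a, 'f, 'r) fo_struct \<Rightarrow> nat \<Rightarrow> ('f, 'r) fm \<Rightarrow> 'a list \<Rightarrow> 'a list set" where
  "defset N p \<psi> b = {a \<in> tuples N p. sat N (a @ b) \<psi>}"

definition distal :: "('f, 'r) fo_lang \<Rightarrow> ('a, 'f, 'r) fo_struct \<Rightarrow> bool" where
  "distal L N \<longleftrightarrow>
     (\<forall>p q \<phi>. formula L (p + q) \<phi> \<longrightarrow>
       (\<exists>m \<theta>. formula L (p + m * q) \<theta> \<and>
         (\<forall>B. finite B \<and> B \<subseteq> tuples N q \<and> card B \<ge> 2 \<longrightarrow>
           (\<forall>a \<in> tuples N p.
             \<exists>bs. length bs = m \<and> set bs \<subseteq> B \<and> sat N (a @ concat bs) \<theta> \<and>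
               (\<forall>b \<in> B. defset N p \<theta> (concat bs) \<subseteq> defset N p \<phi> b \<or>
                 defset N p \<phi> b \<inter> defset N p \<theta> (concat bs) = {})))))"


section \<open>Ramsey growth\<close>

fun twr :: "nat \<Rightarrow> nat \<Rightarrow> nat" where
  "twr (Suc 0) n = n"
| "twr (Suc (Suc i)) n = 2 ^ twr (Suc i) n"

text \<open>Finite sequences are lists, and a \<open>k\<close>-ary relation on a set \<open>X\<close> is a predicate on the lists of
  length \<open>k\<close> over \<open>X\<close>.\<close>

definition indiscernible :: "nat \<Rightarrow> ('b list \<Rightarrow> bool) \<Rightarrow> 'b list \<Rightarrow> bool" where
  "indiscernible k E s \<longleftrightarrow>
     (\<forall>is. length is = k \<and> sorted_wrt (<) is \<and> set is \<subseteq> {..<length s} \<longrightarrow> E (map ((!) s) is)) \<or>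
     (\<forall>is. length is = k \<and> sorted_wrt (<) is \<and> set is \<subseteq> {..<length s} \<longrightarrow> \<not> E (map ((!) s) is))"

text \<open>A formula \<open>\<phi>(x\<^sub>1, \<dots>, x\<^sub>k; z)\<close> with \<open>|x\<^sub>i| = d\<close> and \<open>|z| = e\<close> is a formula in \<open>k * d + e\<close>
  variables, taken in this order. \<open>def_rel M \<phi> b\<close> is the relation defined by
  \<open>\<phi>(x\<^sub>1, \<dots>, x\<^sub>k; b)\<close> on \<open>d\<close>-tuples.\<close>

definition def_rel :: "('a, 'f, 'r) fo_struct \<Rightarrow> ('f, 'r) fm \<Rightarrow> 'a list \<Rightarrow> 'a list list \<Rightarrow> bool" where
  "def_rel M \<phi> b as \<longleftrightarrow> sat M (concat as @ b) \<phi>"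

definition ramsey_num ::
    "('a, 'f, 'r) fo_struct \<Rightarrow> nat \<Rightarrow> nat \<Rightarrow> ('f, 'r) fm \<Rightarrow> 'a list \<Rightarrow> nat \<Rightarrow> nat" where
  "ramsey_num M k d \<phi> b n =
     (LEAST l. \<forall>s. length s = l \<and> set s \<subseteq> tuples M d \<longrightarrow>
       (\<exists>t. subseq t s \<and> length t = n \<and> indiscernible k (def_rel M \<phi> b) t))"

text \<open>By Ramsey's theorem the least number above exists and is bounded independently of \<open>b\<close>, so the
  maximum is that of a finite set; it is nonempty if the structure is.\<close>

definition ramsey_star ::
    "('a, 'f, 'r) fo_struct \<Rightarrow> nat \<Rightarrow> nat \<Rightarrow> nat \<Rightarrow> ('f, 'r) fm \<Rightarrow> nat \<Rightarrow> nat" where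
  "ramsey_star M k d e \<phi> n = Max ((\<lambda>b. ramsey_num M k d \<phi> b n) ` tuples M e)"

end

theory Submission
  imports Defs "HOL-Library.FuncSet"
begin

text \<open>
  Distality provides, for each formula \<open>\<phi>(x, y)\<close>, a number \<open>m\<close> such that over any finite parameter set \<open>B\<close> the
  \<open>x\<close>-space is covered by cells, each spanned by \<open>m\<close> elements of \<open>B\<close>, on which no \<open>\<phi>(x, b)\<close> with \<open>b \<in> B\<close> changes
  its truth value. Two consequences give the tower bound.

  First, a random sample of bounded size already spans cells that most of \<open>B\<close> do not cross (a cutting
  lemma in the style of Clarkson and Shor, \<open>small_sample\<close>). So two finite sequences always have subsequences of
  a constant proportion between which \<open>\<phi>\<close> is constant (\<open>homogeneous_pair\<close>). Applied to the two halves of a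
  sequence and iterated, this makes the product of the largest clique and the largest anticlique at least a
  power of the length, which is the case of binary relations (\<open>polynomial_ramsey_binary\<close>), with
  \<open>twr 1 (n ^ c) = n ^ c\<close>.

  Second, there are at most \<open>|B| ^ m\<close> types over \<open>B\<close>, or two if \<open>B\<close> is a singleton (\<open>few_types\<close>). In the argument
  of Erdos and Rado one picks elements one after another and keeps, each time, the most frequent type over the
  elements picked so far. With polynomially many types, about \<open>2 ^ (C * y\<^sup>2)\<close> elements give a subsequence of
  length \<open>y + 1\<close> in which the last argument of the relation does not matter
  (\<open>end_homogeneous_subsequence\<close>). Fixing it to be the final element lowers the arity by one. So
  \<open>R\<^sub>k\<^sub>+\<^sub>1(n)\<close> is at most \<open>2\<close> to a power of \<open>R\<^sub>k(n)\<close>, and that power is absorbed into the exponent \<open>c\<close>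
  (\<open>twr_power4\<close>). All constants come from the formula alone, hence are uniform in the parameter \<open>b\<close>.
\<close>

section \<open>Pigeonhole, subsequences and indiscernibility\<close>

lemma pigeonhole_list:
  assumes "finite C" "h ` set xs \<subseteq> C" "xs \<noteq> []"
  shows "\<exists>c\<in>C. length xs \<le> card C * length (filter (\<lambda>x. h x = c) xs)"
proof (rule ccontr)
  assume neg: "\<not> ?thesis"
  have "C \<noteq> {}" using assms by auto
  have "length xs = (\<Sum>c\<in>C. length (filter (\<lambda>x. h x = c) xs))"
    using assms(2)
  proof (induction xs)
    case (Cons x xs)
    have "(\<Sum>c\<in>C. length (filter (\<lambda>z. h z = c) (x # xs))) =
        (\<Sum>c\<in>C. (if h x = c then 1 else 0) + length (filter (\<lambda>z. h z = c) xs))"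
      by (intro sum.cong) auto
    also have "\<dots> = 1 + length xs"
      using Cons assms(1) by (simp add: sum.distrib)
    finally show ?case by simp
  qed simp
  then have "card C * length xs = (\<Sum>c\<in>C. card C * length (filter (\<lambda>x. h x = c) xs))"
    by (metis sum_distrib_left)
  also have "\<dots> < (\<Sum>c\<in>C. length xs)"
    using neg \<open>C \<noteq> {}\<close> assms(1) by (intro sum_strict_mono) (auto simp: not_le)
  finally show False by simp
qed

lemma subseq_set_subset: "subseq u t \<Longrightarrow> set u \<subseteq> set t"
  by (induction rule: list_emb.induct) auto

lemma subseq_takeI: "subseq p s \<Longrightarrow> subseq (take n p) s"
  by (rule subseq_order.trans[OF prefix_imp_subseq[OF take_is_prefix]])

lemma sorted_wrt_subseq:
  assumes "subseq u t" "sorted_wrt P t"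
  shows "sorted_wrt P u"
  using assms
proof (induction rule: list_emb.induct)
  case (list_emb_Cons2 x y xs ys)
  then show ?case using list_emb_set by fastforce
qed auto

lemma map_nth_is_subseq:
  assumes "sorted_wrt (<) is" "set is \<subseteq> {..<length s}"
  shows "subseq (map ((!) s) is) s"
proof -
  have "is = filter (\<lambda>i. i \<in> set is) [0..<length s]"
    using assms
    by (intro sorted_distinct_set_unique)
      (auto simp: strict_sorted_iff intro!: distinct_filter sorted_wrt_filter)
  then have "subseq is [0..<length s]"
    by (metis subseq_filter_left)
  then have "subseq (map ((!) s) is) (map ((!) s) [0..<length s])"
    by (rule subseq_map)
  then show ?thesis by (simp add: map_nth)
qed

lemma indiscernibleI:
  assumes "(\<forall>u. subseq u s \<and> length u = k \<longrightarrow> E u) \<or> (\<forall>u. subseq u s \<and> length u = k \<longrightarrow> \<not> E u)"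
  shows "indiscernible k E s"
  using assms unfolding indiscernible_def by (metis length_map map_nth_is_subseq)

lemma subseq_index_list:
  assumes "subseq u s"
  shows "\<exists>is. sorted_wrt (<) is \<and> set is \<subseteq> {..<length s} \<and> u = map ((!) s) is"
  using assms
proof (induction rule: list_emb.induct)
  case (list_emb_Nil ys)
  show ?case by (intro exI[of _ "[]"]) simp
next
  case (list_emb_Cons xs ys y)
  then obtain "is" where "sorted_wrt (<) is" "set is \<subseteq> {..<length ys}" "xs = map ((!) ys) is" by auto
  then show ?case by (intro exI[of _ "map Suc is"]) (auto simp: sorted_wrt_map)
next
  case (list_emb_Cons2 x y xs ys)
  then obtain "is" where "sorted_wrt (<) is" "set is \<subseteq> {..<length ys}" "xs = map ((!) ys) is" by auto
  then show ?case using list_emb_Cons2(1)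
    by (intro exI[of _ "0 # map Suc is"]) (auto simp: sorted_wrt_map)
qed

text \<open>Sublists replace strictly increasing index lists: the sublists of length \<open>k\<close> are the lists of values
  along such index lists. Passing to a subsequence then only needs transitivity of \<open>subseq\<close>.\<close>

lemma indiscernible_iff:
  "indiscernible k E s \<longleftrightarrow>
    (\<forall>u. subseq u s \<and> length u = k \<longrightarrow> E u) \<or> (\<forall>u. subseq u s \<and> length u = k \<longrightarrow> \<not> E u)"
proof
  assume "indiscernible k E s"
  then show "(\<forall>u. subseq u s \<and> length u = k \<longrightarrow> E u) \<or> (\<forall>u. subseq u s \<and> length u = k \<longrightarrow> \<not> E u)"
    unfolding indiscernible_def by (metis length_map subseq_index_list)
qed (rule indiscernibleI)

section \<open>Cells and random samples\<close>

text \<open>The combinatorial content of distality, without formulas. The cell \<open>T bs\<close> stands for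
  \<open>\<theta>(N, b\<^sub>1, \<dots>, b\<^sub>m)\<close>: every point of \<open>X\<close> lies in a cell that is spanned by \<open>m\<close> parameters from \<open>B\<close> and that
  no \<open>b \<in> B\<close> crosses, where \<open>b\<close> crosses a set if \<open>R \<cdot> b\<close> is not constant on it. Since \<open>m\<close> does not depend on
  \<open>B\<close>, both the polynomial number of types and the cutting argument below follow from this alone.\<close>

definition distal_cells ::
    "'x set \<Rightarrow> 'y set \<Rightarrow> nat \<Rightarrow> ('y list \<Rightarrow> 'x set) \<Rightarrow> ('x \<Rightarrow> 'y \<Rightarrow> bool) \<Rightarrow> bool" where
  "distal_cells X Y m T R \<longleftrightarrow> (\<forall>B. finite B \<and> B \<subseteq> Y \<and> card B \<ge> 2 \<longrightarrow>
     (\<forall>a\<in>X. \<exists>bs. length bs = m \<and> set bs \<subseteq> B \<and> a \<in> T bs \<and>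
       (\<forall>b\<in>B. (\<forall>x\<in>T bs. R x b) \<or> (\<forall>x\<in>T bs. \<not> R x b))))"

lemma distal_cellsD:
  assumes "distal_cells X Y m T R" "finite B" "B \<subseteq> Y" "card B \<ge> 2" "a \<in> X"
  shows "\<exists>bs. length bs = m \<and> set bs \<subseteq> B \<and> a \<in> T bs \<and>
    (\<forall>b\<in>B. (\<forall>x\<in>T bs. R x b) \<or> (\<forall>x\<in>T bs. \<not> R x b))"
  using assms(1)[unfolded distal_cells_def, rule_format, OF _ assms(5)] assms(2-4) by simp

text \<open>The probability bound in the Clarkson--Shor argument, as a count of samples \<open>f\<close> of size \<open>r\<close>. The set
  \<open>cross f\<close> is determined by the at most \<open>m\<close> entries of \<open>f\<close> at the positions in \<open>P\<close>. Once these are fixed, each of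
  the other \<open>r - m\<close> or more entries has to avoid a set with at least half of the elements of \<open>J\<close>, which at most
  half of the choices do.\<close>

lemma card_avoiding_samples:
  fixes J :: "'j set" and cross :: "(nat \<Rightarrow> 'j) \<Rightarrow> 'j set"
  assumes J: "finite J" and P: "P \<subseteq> {..<r}" "card P \<le> m"
    and dep: "\<And>f g. (\<And>i. i \<in> P \<Longrightarrow> f i = g i) \<Longrightarrow> cross f = cross g"
  shows "2 ^ (r - m) * card {f \<in> {..<r} \<rightarrow>\<^sub>E J. card J \<le> 2 * card (J \<inter> cross f) \<and> (\<forall>i<r. f i \<notin> cross f)}
    \<le> card J ^ r" (is "_ * card ?bad \<le> _")
proof -
  define Q where "Q = {..<r} - P"
  have fP: "finite P" using P finite_subset by blast
  have fQ: "finite Q" unfolding Q_def by simp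
  have cPQ: "card P + card Q = r"
    using P fP card_mono[OF _ P(1)] unfolding Q_def by (simp add: card_Diff_subset)
  \<comment> \<open>Fibres of bad samples over their restrictions to \<open>P\<close>: \<open>cross\<close> is constant on each fibre.\<close>
  define fib where "fib g = {f \<in> ?bad. restrict f P = g}" for g
  have "finite ({..<r} \<rightarrow>\<^sub>E J)" using J by (intro finite_PiE) auto
  then have finbad: "finite ?bad" by simp
  have fibcard: "2 ^ card Q * card (fib g) \<le> card J ^ card Q" for g
  proof (cases "fib g = {}")
    case False
    have same: "cross f = cross g" if "f \<in> fib g" for f
      using that unfolding fib_def by (intro dep) auto
    from False obtain f0 where f0: "f0 \<in> fib g" by blast
    then have "card J \<le> 2 * card (J \<inter> cross f0)" unfolding fib_def by simp
    then have half: "card J \<le> 2 * card (J \<inter> cross g)"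
      using same[OF f0] by simp
    have "card (J - cross g) + card (J \<inter> cross g) = card J"
      by (metis J card_Int_Diff add.commute)
    then have half': "2 * card (J - cross g) \<le> card J" using half by linarith
    have "inj_on (\<lambda>f. restrict f Q) (fib g)"
    proof (rule inj_onI)
      fix f f' assume ff: "f \<in> fib g" "f' \<in> fib g" "restrict f Q = restrict f' Q"
      show "f = f'"
      proof
        fix i
        consider "i \<in> P" | "i \<in> Q" | "i \<notin> {..<r}" unfolding Q_def by auto
        then show "f i = f' i"
        proof cases
          case 1
          have "restrict f P = restrict f' P" using ff(1,2) by (simp add: fib_def)
          then show ?thesis using 1 by (metis restrict_apply')
        next
          case 2 then show ?thesis using ff(3) by (metis restrict_apply')
        next
          case 3
          have "f \<in> {..<r} \<rightarrow>\<^sub>E J" "f' \<in> {..<r} \<rightarrow>\<^sub>E J" using ff(1,2) by (simp_all add: fib_def)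
          then show ?thesis using 3 by (metis PiE_arb)
        qed
      qed
    qed
    moreover have "(\<lambda>f. restrict f Q) ` fib g \<subseteq> Q \<rightarrow>\<^sub>E (J - cross g)"
    proof (intro image_subsetI)
      fix f assume f: "f \<in> fib g"
      have "f i \<in> J - cross g" if "i \<in> Q" for i
        using f that same[OF f] unfolding fib_def Q_def by (auto simp: PiE_iff)
      then show "restrict f Q \<in> Q \<rightarrow>\<^sub>E (J - cross g)" by (simp add: PiE_iff)
    qed
    ultimately have "card (fib g) \<le> card (Q \<rightarrow>\<^sub>E (J - cross g))"
      using J fQ by (intro card_inj_on_le[where f = "\<lambda>f. restrict f Q"]) (auto intro!: finite_PiE)
    also have "\<dots> = card (J - cross g) ^ card Q"
      using fQ by (simp add: card_PiE)
    finally have "2 ^ card Q * card (fib g) \<le> (2 * card (J - cross g)) ^ card Q"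
      by (simp add: power_mult_distrib)
    also have "\<dots> \<le> card J ^ card Q" using half' by (rule power_mono) simp
    finally show ?thesis .
  qed simp
  have fPE: "finite (P \<rightarrow>\<^sub>E J)" using fP J by (intro finite_PiE) auto
  have ffib: "finite (fib g)" for g
    by (rule finite_subset[OF _ finbad]) (auto simp: fib_def)
  have "?bad \<subseteq> (\<Union>g\<in>P \<rightarrow>\<^sub>E J. fib g)"
  proof
    fix f assume f: "f \<in> ?bad"
    then have "restrict f P \<in> P \<rightarrow>\<^sub>E J" using P(1) by (auto simp: PiE_iff)
    moreover have "f \<in> fib (restrict f P)" using f unfolding fib_def by blast
    ultimately show "f \<in> (\<Union>g\<in>P \<rightarrow>\<^sub>E J. fib g)" by blast
  qed
  then have "card ?bad \<le> card (\<Union>g\<in>P \<rightarrow>\<^sub>E J. fib g)"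
    using fPE ffib by (intro card_mono finite_UN_I)
  also have "\<dots> \<le> (\<Sum>g\<in>P \<rightarrow>\<^sub>E J. card (fib g))" using fPE by (rule card_UN_le)
  finally have "card ?bad \<le> (\<Sum>g\<in>P \<rightarrow>\<^sub>E J. card (fib g))" .
  then have "2 ^ card Q * card ?bad \<le> (\<Sum>g\<in>P \<rightarrow>\<^sub>E J. 2 ^ card Q * card (fib g))"
    by (simp add: sum_distrib_left[symmetric])
  also have "\<dots> \<le> (\<Sum>g\<in>P \<rightarrow>\<^sub>E J. card J ^ card Q)" by (intro sum_mono fibcard)
  also have "\<dots> = card J ^ r"
    using fP cPQ by (simp add: card_PiE power_add[symmetric])
  finally have "2 ^ card Q * card ?bad \<le> card J ^ r" .
  moreover have "(2::nat) ^ (r - m) \<le> 2 ^ card Q"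
    using cPQ P(2) by (intro power_increasing) auto
  ultimately show ?thesis by (meson le_trans mult_le_mono1)
qed

text \<open>A weak net. For a random sample the union bound over the \<open>(r + 2) ^ m\<close> choices of positions shows that
  some sample works for all of them at once: every set \<open>cross js\<close> spanned by sample points either meets the
  sample or is smaller than half of \<open>J\<close>. The two given points \<open>u\<close> and \<open>v\<close> are put into the sample because
  cells are only available for sets of at least two parameters.\<close>

lemma small_sample:
  fixes J :: "'j set" and cross :: "'j list \<Rightarrow> 'j set"
  assumes J: "finite J" "u \<in> J" "v \<in> J" and r: "(r + 2) ^ m < 2 ^ (r - m)"
  shows "\<exists>S. {u, v} \<subseteq> S \<and> S \<subseteq> J \<and> card S \<le> r + 2 \<and>
    (\<forall>js. length js = m \<and> set js \<subseteq> S \<and> S \<inter> cross js = {} \<longrightarrow> 2 * card (J \<inter> cross js) < card J)"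
proof -
  \<comment> \<open>The sample extended by \<open>u\<close> and \<open>v\<close> at positions \<open>r\<close> and \<open>r + 1\<close>.\<close>
  define ext where "ext f i = (if i < r then f i else if i = r then u else v)" for f :: "nat \<Rightarrow> 'j" and i
  define pos where "pos = {p :: nat list. set p \<subseteq> {..<r+2} \<and> length p = m}"
  define bad where "bad p = {f \<in> {..<r} \<rightarrow>\<^sub>E J. card J \<le> 2 * card (J \<inter> cross (map (ext f) p)) \<and>
      (\<forall>i<r. f i \<notin> cross (map (ext f) p))}" for p
  have fpos: "finite pos" "card pos = (r + 2) ^ m"
    using finite_lists_length_eq[of "{..<r+2}" m] card_lists_length_eq[of "{..<r+2}" m]
    by (auto simp: pos_def)
  have badcard: "2 ^ (r - m) * card (bad p) \<le> card J ^ r" if "p \<in> pos" for p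
    unfolding bad_def
  proof (rule card_avoiding_samples[where P = "set p \<inter> {..<r}"])
    show "card (set p \<inter> {..<r}) \<le> m"
      using that card_length[of p] card_mono[of "set p" "set p \<inter> {..<r}"]
      unfolding pos_def by auto
    fix f g :: "nat \<Rightarrow> 'j" assume "\<And>i. i \<in> set p \<inter> {..<r} \<Longrightarrow> f i = g i"
    then have "map (ext f) p = map (ext g) p"
      unfolding ext_def by (intro map_cong refl) simp
    then show "cross (map (ext f) p) = cross (map (ext g) p)" by (rule arg_cong)
  qed (use J in auto)
  have Jpos: "card J ^ r > 0" using J card_gt_0_iff by auto
  have "2 ^ (r - m) * card (\<Union>p\<in>pos. bad p) \<le> 2 ^ (r - m) * (\<Sum>p\<in>pos. card (bad p))"
    using fpos by (intro mult_le_mono2 card_UN_le) auto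
  also have "\<dots> = (\<Sum>p\<in>pos. 2 ^ (r - m) * card (bad p))" by (simp add: sum_distrib_left)
  also have "\<dots> \<le> (\<Sum>p\<in>pos. card J ^ r)" by (intro sum_mono badcard)
  also have "\<dots> = (r + 2) ^ m * card J ^ r" using fpos by simp
  also have "\<dots> < 2 ^ (r - m) * card J ^ r" using r Jpos by simp
  finally have "card (\<Union>p\<in>pos. bad p) < card ({..<r} \<rightarrow>\<^sub>E J)"
    by (simp add: card_PiE)
  moreover have "finite (\<Union>p\<in>pos. bad p)"
  proof (intro finite_UN_I fpos)
    fix p
    have "finite ({..<r} \<rightarrow>\<^sub>E J)" using J(1) by (intro finite_PiE) auto
    then show "finite (bad p)" unfolding bad_def by simp
  qed
  ultimately have "\<not> ({..<r} \<rightarrow>\<^sub>E J) \<subseteq> (\<Union>p\<in>pos. bad p)"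
    by (meson card_mono not_le)
  then obtain f where f: "f \<in> {..<r} \<rightarrow>\<^sub>E J" "\<And>p. p \<in> pos \<Longrightarrow> f \<notin> bad p"
    by blast
  define S where "S = ext f ` {..<r+2}"
  have "{u, v} \<subseteq> S" 
  proof -
    have "ext f r \<in> S" "ext f (r + 1) \<in> S" unfolding S_def by simp_all
    then show ?thesis by (simp add: ext_def)
  qed
  moreover have "S \<subseteq> J" using f(1) J unfolding S_def ext_def by (auto simp: PiE_iff)
  moreover have "card S \<le> r + 2" unfolding S_def using card_image_le[of "{..<r+2}" "ext f"] by simp
  moreover have "2 * card (J \<inter> cross js) < card J"
    if js: "length js = m" "set js \<subseteq> S" "S \<inter> cross js = {}" for js
  proof -
    have "\<forall>j\<in>set js. \<exists>i<r+2. j = ext f i" using js(2) unfolding S_def by auto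
    then obtain h where h: "\<And>j. j \<in> set js \<Longrightarrow> h j < r + 2 \<and> j = ext f (h j)" by metis
    have eq: "map (ext f) (map h js) = js" using h by (simp add: map_idI)
    have "map h js \<in> pos" using h js(1) unfolding pos_def by auto
    then have "f \<notin> bad (map h js)" by (rule f)
    moreover have "f i \<notin> cross js" if "i < r" for i
    proof -
      have "ext f i \<in> S" using that unfolding S_def by auto
      then show ?thesis using js(3) that unfolding ext_def by auto
    qed
    ultimately show ?thesis using f(1) eq unfolding bad_def by auto
  qed
  ultimately show ?thesis by blast
qed

lemma exists_sample_size: "\<exists>r. (r + 2) ^ m < (2::nat) ^ (r - m)"
proof -
  \<comment> \<open>With \<open>r + 2\<close> the power of two \<open>2 ^ (2 * w)\<close>, the claim compares exponents:
    \<open>2 * w * m < 2 ^ (2 * w) - 2 - m\<close>.\<close>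
  define w where "w = 2 * m + 3"
  define r where "r = (2::nat) ^ (2 * w) - 2"
  have "Suc w \<le> 2 ^ w" by (simp add: Suc_le_eq)
  then have "(Suc w)^2 \<le> (2 ^ w)^2" by (rule power_mono) simp
  also have "\<dots> = (2::nat) ^ (2 * w)" by (simp add: power_mult[symmetric] mult.commute)
  finally have big: "(w+1)*(w+1) \<le> (2::nat) ^ (2 * w)" by (simp add: power2_eq_square)
  have "2 * w * m + m + 2 < (w+1)*(w+1)" unfolding w_def by (simp add: algebra_simps)
  with big have lt: "2 * w * m + m + 2 < 2 ^ (2 * w)" by linarith
  then have "r + 2 = 2 ^ (2 * w)" unfolding r_def by simp
  then have "(r + 2) ^ m = 2 ^ (2 * w * m)" by (simp add: power_mult)
  also have "\<dots> < 2 ^ (r - m)" using lt unfolding r_def by (intro power_strict_increasing) auto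
  finally show ?thesis by blast
qed

text \<open>The strong Erdos--Hajnal property. Take a sample \<open>S\<close> of bounded size from \<open>ys\<close> as above. Each point of \<open>xs\<close>
  lies in a cell spanned by \<open>S\<close> that no element of \<open>S\<close> crosses, hence that fewer than half of \<open>ys\<close> cross. There are
  boundedly many such cells, so one of them contains a constant fraction of \<open>xs\<close>; of the uncrossing elements of
  \<open>ys\<close>, either half relate to the whole cell or half relate to nothing in it.\<close>

lemma homogeneous_pair:
  assumes cells: "distal_cells X Y m T R"
  shows "\<exists>K>0. \<forall>xs ys. set xs \<subseteq> X \<and> set ys \<subseteq> Y \<longrightarrow>
    (\<exists>xs' ys'. subseq xs' xs \<and> subseq ys' ys \<and>
      length xs \<le> K * length xs' \<and> length ys \<le> K * length ys' \<and>
      ((\<forall>x\<in>set xs'. \<forall>y\<in>set ys'. R x y) \<or> (\<forall>x\<in>set xs'. \<forall>y\<in>set ys'. \<not> R x y)))"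
proof -
  obtain r where r: "(r + 2) ^ m < (2::nat) ^ (r - m)" using exists_sample_size by blast
  \<comment> \<open>The factor \<open>4\<close> is for \<open>ys\<close>, nearly half of which may cross the cell; \<open>(r + 2) ^ m\<close> counts the cells.\<close>
  define K where "K = 4 * (r + 2) ^ m"
  have K4: "K \<ge> 4" "K \<ge> (r+2)^m" unfolding K_def by (auto simp: Suc_le_eq)
  have Kmul: "l \<le> K * l'" if "l \<le> 4 * l' \<or> l \<le> (r+2)^m * l'" for l l'
    using that K4 by (meson le_trans mult_le_mono1)
  have "\<exists>xs' ys'. subseq xs' xs \<and> subseq ys' ys \<and>
      length xs \<le> K * length xs' \<and> length ys \<le> K * length ys' \<and>
      ((\<forall>x\<in>set xs'. \<forall>y\<in>set ys'. R x y) \<or> (\<forall>x\<in>set xs'. \<forall>y\<in>set ys'. \<not> R x y))"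
    (is "\<exists>xs' ys'. ?good xs' ys'")
    if xs: "set xs \<subseteq> X" and ys: "set ys \<subseteq> Y" for xs ys
  proof -
    consider "xs = []" | "xs \<noteq> []" "\<exists>y. set ys \<subseteq> {y}"
      | "xs \<noteq> []" "\<exists>u v. u < length ys \<and> v < length ys \<and> ys ! u \<noteq> ys ! v"
      by (metis in_set_conv_nth singleton_iff subsetI)
    then show ?thesis
    proof cases
      case 1
      have "?good [] ys" using 1 Kmul[of "length ys" "length ys"] by auto
      then show ?thesis by blast
    next
      case 2
      then obtain y where y: "set ys \<subseteq> {y}" by blast
      obtain c where c: "length xs \<le> card (UNIV :: bool set) * length (filter (\<lambda>x. R x y = c) xs)"
        using pigeonhole_list[of "UNIV :: bool set" "\<lambda>x. R x y" xs] 2 by auto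
      have "?good (filter (\<lambda>x. R x y = c) xs) ys"
        using c y Kmul by (cases c) (auto simp: subset_iff)
      then show ?thesis by blast
    next
      case 3
      then obtain u v where uv: "u < length ys" "v < length ys" "ys ! u \<noteq> ys ! v" by blast
      define crossing where "crossing bs y \<longleftrightarrow> \<not> ((\<forall>x\<in>T bs. R x y) \<or> (\<forall>x\<in>T bs. \<not> R x y))" for bs y
      define cross where "cross js = {j. crossing (map ((!) ys) js) (ys ! j)}" for js
      define J where "J = {..<length ys}"
      have J: "finite J" "u \<in> J" "v \<in> J" using uv unfolding J_def by auto
      obtain S where S: "{u, v} \<subseteq> S" "S \<subseteq> J" "card S \<le> r + 2"
        and Sgood: "\<And>js. length js = m \<Longrightarrow> set js \<subseteq> S \<Longrightarrow> S \<inter> cross js = {} \<Longrightarrow>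
          2 * card (J \<inter> cross js) < card J"
        using small_sample[OF J r, of cross] by blast
      have fS: "finite S" using S(2) J(1) finite_subset by blast
      define B where "B = (!) ys ` S"
      have "card {ys ! u, ys ! v} \<le> card B"
        unfolding B_def using S(1) fS by (intro card_mono) auto
      then have "card B \<ge> 2" using uv(3) by simp
      moreover have "B \<subseteq> Y" using S(2) ys unfolding B_def J_def
        by (metis image_subsetI lessThan_iff nth_mem subsetD)
      moreover have "finite B" using fS unfolding B_def by simp
      ultimately have B: "2 \<le> card B" "B \<subseteq> Y" "finite B" by auto
      have cell: "\<exists>bs. length bs = m \<and> set bs \<subseteq> B \<and> a \<in> T bs \<and> (\<forall>b\<in>B. \<not> crossing bs b)"
        if a: "a \<in> X" for a
      proof -
        obtain bs where bs: "length bs = m" "set bs \<subseteq> B" "a \<in> T bs"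
            "\<forall>b\<in>B. (\<forall>x\<in>T bs. R x b) \<or> (\<forall>x\<in>T bs. \<not> R x b)"
          using distal_cellsD[OF cells B(3,2,1) a] by blast
        from bs(4) have "\<forall>b\<in>B. \<not> crossing bs b" by (simp add: crossing_def)
        with bs(1-3) show ?thesis by blast
      qed
      have "\<exists>js. length js = m \<and> set js \<subseteq> S \<and> a \<in> T (map ((!) ys) js) \<and> S \<inter> cross js = {}"
        if a: "a \<in> X" for a
      proof -
        obtain bs where bs: "length bs = m" "set bs \<subseteq> B" "a \<in> T bs" "\<forall>b\<in>B. \<not> crossing bs b"
          using cell[OF a] by blast
        have "bs \<in> lists ((!) ys ` S)" using bs(2) unfolding B_def by auto
        then obtain js where js: "js \<in> lists S" "bs = map ((!) ys) js" by (auto simp: lists_image)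
        then show ?thesis using bs unfolding cross_def B_def by (intro exI[of _ js]) auto
      qed
      then obtain h where h: "\<And>a. a \<in> X \<Longrightarrow> length (h a) = m \<and> set (h a) \<subseteq> S \<and>
          a \<in> T (map ((!) ys) (h a)) \<and> S \<inter> cross (h a) = {}" by metis
      define C where "C = {js. set js \<subseteq> S \<and> length js = m}"
      have C: "finite C" "card C \<le> (r+2)^m"
        using finite_lists_length_eq[OF fS, of m] card_lists_length_eq[OF fS, of m] S(3)
        by (auto simp: C_def power_mono)
      have "h ` set xs \<subseteq> C" using h xs unfolding C_def by blast
      from pigeonhole_list[OF C(1) this 3(1)] obtain js
        where js: "length xs \<le> card C * length (filter (\<lambda>x. h x = js) xs)" by blast
      define xs' where "xs' = filter (\<lambda>x. h x = js) xs"
      have len_xs: "length xs \<le> (r+2)^m * length xs'"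
        using js C(2) unfolding xs'_def by (meson le_trans mult_le_mono1)
      have "xs' \<noteq> []" using len_xs 3 by auto
      then obtain x0 where x0: "x0 \<in> X" "h x0 = js"
        using xs unfolding xs'_def by (fastforce simp: filter_empty_conv)
      define D where "D = T (map ((!) ys) js)"
      have inD: "x \<in> D" if "x \<in> set xs'" for x
        using that h xs unfolding xs'_def D_def by auto
      have few: "2 * card (J \<inter> cross js) < card J"
        using h[OF x0(1)] x0(2) by (intro Sgood) auto
      let ?all = "\<lambda>y. \<forall>x\<in>D. R x y" and ?none = "\<lambda>y. \<forall>x\<in>D. \<not> R x y"
      have "card J \<le> card (J \<inter> cross js) + (card {j. j < length ys \<and> ?all (ys!j)} +
          card {j. j < length ys \<and> ?none (ys!j)})" (is "_ \<le> card ?c + (card ?a + card ?n)")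
      proof -
        have "J \<subseteq> ?c \<union> (?a \<union> ?n)"
          unfolding cross_def crossing_def J_def D_def[symmetric] by auto
        moreover have "finite (?c \<union> (?a \<union> ?n))" using J by auto
        ultimately have "card J \<le> card (?c \<union> (?a \<union> ?n))" by (rule card_mono[rotated])
        also have "\<dots> \<le> card ?c + card (?a \<union> ?n)" by (rule card_Un_le)
        also have "\<dots> \<le> card ?c + (card ?a + card ?n)" using card_Un_le by (intro add_left_mono)
        finally show ?thesis .
      qed
      then have "length ys \<le> 4 * length (filter ?all ys) \<or> length ys \<le> 4 * length (filter ?none ys)"
        using few unfolding length_filter_conv_card J_def by simp linarith
      then show ?thesis
      proof
        assume "length ys \<le> 4 * length (filter ?all ys)"
        then have "?good xs' (filter ?all ys)"
          using len_xs Kmul inD unfolding xs'_def by auto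
        then show ?thesis by blast
      next
        assume "length ys \<le> 4 * length (filter ?none ys)"
        then have "?good xs' (filter ?none ys)"
          using len_xs Kmul inD unfolding xs'_def by auto
        then show ?thesis by blast
      qed
    qed
  qed
  moreover have "K > 0" using K4 by simp
  ultimately show ?thesis by blast
qed

section \<open>A polynomial Ramsey bound for binary relations\<close>

text \<open>Split \<open>s\<close> into a first and a second half and take a homogeneous pair in them. If \<open>R\<close> holds on the pair,
  cliques \<open>p\<^sub>1, p\<^sub>2\<close> of the two parts concatenate to a clique, while the longer of the two anticliques survives:
  \<open>(|p\<^sub>1| + |p\<^sub>2|) * max |q\<^sub>1| |q\<^sub>2| \<ge> |p\<^sub>1| * |q\<^sub>1| + |p\<^sub>2| * |q\<^sub>2|\<close>. So the product doubles whenever the length grows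
  by the constant factor \<open>2 * K\<close>. The halves are used in their order in \<open>s\<close>, so \<open>R\<close> need not be symmetric.\<close>

lemma clique_times_anticlique:
  fixes R :: "'x \<Rightarrow> 'x \<Rightarrow> bool"
  assumes K: "K > 0"
    and pair: "\<And>xs ys. set xs \<subseteq> X \<Longrightarrow> set ys \<subseteq> X \<Longrightarrow> \<exists>xs' ys'. subseq xs' xs \<and> subseq ys' ys \<and>
      length xs \<le> K * length xs' \<and> length ys \<le> K * length ys' \<and>
      ((\<forall>x\<in>set xs'. \<forall>y\<in>set ys'. R x y) \<or> (\<forall>x\<in>set xs'. \<forall>y\<in>set ys'. \<not> R x y))"
    and s: "set s \<subseteq> X" "length s \<ge> (2 * K) ^ t"
  shows "\<exists>p q. subseq p s \<and> subseq q s \<and> sorted_wrt R p \<and> sorted_wrt (\<lambda>x y. \<not> R x y) q \<and>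
    2 ^ t \<le> length p * length q"
  using s
proof (induction t arbitrary: s)
  case 0
  then obtain x where "x \<in> set s" by (cases s) auto
  then have "subseq [x] s" by (simp add: subseq_singleton_left)
  then show ?case by (intro exI[of _ "[x]"]) simp
next
  case (Suc t)
  define h where "h = K * (2 * K) ^ t"
  have "2 * h \<le> length s" using Suc.prems(2) unfolding h_def by (simp add: mult.assoc)
  then have len: "length (take h s) \<ge> h" "length (drop h s) \<ge> h" by simp_all
  have "set (take h s) \<subseteq> X" "set (drop h s) \<subseteq> X"
    by (rule subset_trans[OF set_take_subset Suc.prems(1)], rule subset_trans[OF set_drop_subset Suc.prems(1)])
  from pair[OF this] obtain s1 s2 where ss: "subseq s1 (take h s)" "subseq s2 (drop h s)"
    and l: "length (take h s) \<le> K * length s1" "length (drop h s) \<le> K * length s2"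
    and hom: "(\<forall>x\<in>set s1. \<forall>y\<in>set s2. R x y) \<or> (\<forall>x\<in>set s1. \<forall>y\<in>set s2. \<not> R x y)"
    by blast
  have sub: "subseq (u1 @ u2) s" if "subseq u1 s1" "subseq u2 s2" for u1 u2
  proof -
    have "subseq (u1 @ u2) (take h s @ drop h s)"
      using that ss by (meson list_emb_append_mono subseq_order.trans)
    then show ?thesis by simp
  qed
  have in_s: "set s1 \<subseteq> X" "set s2 \<subseteq> X"
    using sub[of s1 s2] Suc.prems(1) by (auto dest!: subseq_set_subset simp: subset_iff)
  have "K * (2 * K) ^ t \<le> K * length s1" "K * (2 * K) ^ t \<le> K * length s2"
    using len l unfolding h_def by linarith+
  then have "(2 * K) ^ t \<le> length s1" "(2 * K) ^ t \<le> length s2" using K by simp_all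
  then obtain p1 q1 p2 q2 where
    1: "subseq p1 s1" "subseq q1 s1" "sorted_wrt R p1" "sorted_wrt (\<lambda>x y. \<not> R x y) q1"
      "2 ^ t \<le> length p1 * length q1" and
    2: "subseq p2 s2" "subseq q2 s2" "sorted_wrt R p2" "sorted_wrt (\<lambda>x y. \<not> R x y) q2"
      "2 ^ t \<le> length p2 * length q2"
    using Suc.IH in_s by metis
  have sub1: "subseq p1 s" "subseq q1 s" "subseq p2 s" "subseq q2 s"
    using sub[of _ "[]"] sub[of "[]"] 1 2 by auto
  have elems: "set p1 \<subseteq> set s1" "set q1 \<subseteq> set s1" "set p2 \<subseteq> set s2" "set q2 \<subseteq> set s2"
    using 1 2 by (auto dest!: subseq_set_subset)
  have prod: "2 ^ Suc t \<le> (a1 + a2) * c" if "2 ^ t \<le> a1 * b1" "2 ^ t \<le> a2 * b2" "b1 \<le> c" "b2 \<le> c"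
    for a1 a2 b1 b2 c :: nat
  proof -
    have "2 ^ t \<le> a1 * c" "2 ^ t \<le> a2 * c" using that by (meson le_trans mult_le_mono2)+
    then show ?thesis by (simp add: add_mult_distrib)
  qed
  from hom show ?case
  proof
    assume h: "\<forall>x\<in>set s1. \<forall>y\<in>set s2. R x y"
    then have "sorted_wrt R (p1 @ p2)" unfolding sorted_wrt_append using 1 2 elems h by (simp add: subset_iff)
    moreover have "subseq (p1 @ p2) s" using 1 2 sub by blast
    moreover obtain q where "q \<in> {q1, q2}" "length q1 \<le> length q" "length q2 \<le> length q"
      by (meson insertI1 insertI2 nle_le)
    moreover from this have "2 ^ Suc t \<le> length (p1 @ p2) * length q"
      using prod[OF 1(5) 2(5)] by simp
    ultimately show ?thesis using 1(4) 2(4) sub1 by blast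
  next
    assume h: "\<forall>x\<in>set s1. \<forall>y\<in>set s2. \<not> R x y"
    then have "sorted_wrt (\<lambda>x y. \<not> R x y) (q1 @ q2)" unfolding sorted_wrt_append using 1 2 elems h by (simp add: subset_iff)
    moreover have "subseq (q1 @ q2) s" using 1 2 sub by blast
    moreover obtain p where "p \<in> {p1, p2}" "length p1 \<le> length p" "length p2 \<le> length p"
      by (meson insertI1 insertI2 nle_le)
    moreover from this have "2 ^ Suc t \<le> length p * length (q1 @ q2)"
      using prod[of "length q1" "length p1" "length q2" "length p2" "length p"] 1(5) 2(5)
      by (simp add: mult.commute)
    ultimately show ?thesis using 1(3) 2(3) sub1 by blast
  qed
qed

lemma indiscernible_pairs:
  assumes "sorted_wrt (\<lambda>x y. E [x, y] = c) p"
  shows "indiscernible 2 E p"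
proof -
  have "E u = c" if u: "subseq u p" "length u = 2" for u
  proof -
    obtain x y where "u = [x, y]" using u(2) by (auto simp: numeral_2_eq_2 length_Suc_conv)
    then show ?thesis using sorted_wrt_subseq[OF u(1) assms] by simp
  qed
  then show ?thesis unfolding indiscernible_iff by (cases c) auto
qed

text \<open>The map \<open>f\<close> turns an element of the sequence into a parameter; for \<open>\<phi>(x\<^sub>1, x\<^sub>2; b)\<close> it is
  \<open>y \<mapsto> y @ b\<close>. The exponent \<open>c\<close> is chosen before \<open>f\<close>, which makes the bound uniform in \<open>b\<close>.\<close>

lemma polynomial_ramsey_binary:
  assumes cells: "distal_cells X Y m T R"
  shows "\<exists>c>0. \<forall>n\<ge>2. \<forall>f s. f ` X \<subseteq> Y \<and> set s \<subseteq> X \<and> length s \<ge> n ^ c \<longrightarrow>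
    (\<exists>t. subseq t s \<and> length t = n \<and>
      (sorted_wrt (\<lambda>x y. R x (f y)) t \<or> sorted_wrt (\<lambda>x y. \<not> R x (f y)) t))"
proof -
  obtain K where K: "K > 0" and pair: "\<And>xs ys. set xs \<subseteq> X \<and> set ys \<subseteq> Y \<Longrightarrow>
    \<exists>xs' ys'. subseq xs' xs \<and> subseq ys' ys \<and>
      length xs \<le> K * length xs' \<and> length ys \<le> K * length ys' \<and>
      ((\<forall>x\<in>set xs'. \<forall>y\<in>set ys'. R x y) \<or> (\<forall>x\<in>set xs'. \<forall>y\<in>set ys'. \<not> R x y))"
    using homogeneous_pair[OF cells] by blast
  \<comment> \<open>With \<open>n\<^sup>2 \<le> 2 ^ t \<le> n ^ 4\<close>, the length \<open>(2 * K) ^ t \<le> (2 ^ t) ^ (2 * K) \<le> n ^ (8 * K)\<close> suffices.\<close>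
  define c where "c = 8 * K"
  have "\<exists>t. subseq t s \<and> length t = n \<and>
      (sorted_wrt (\<lambda>x y. R x (f y)) t \<or> sorted_wrt (\<lambda>x y. \<not> R x (f y)) t)"
    if n: "n \<ge> 2" and f: "f ` X \<subseteq> Y" and s: "set s \<subseteq> X" "length s \<ge> n ^ c" for n f s
  proof -
    have pair': "\<exists>xs' ys'. subseq xs' xs \<and> subseq ys' ys \<and>
        length xs \<le> K * length xs' \<and> length ys \<le> K * length ys' \<and>
        ((\<forall>x\<in>set xs'. \<forall>y\<in>set ys'. R x (f y)) \<or> (\<forall>x\<in>set xs'. \<forall>y\<in>set ys'. \<not> R x (f y)))"
      if "set xs \<subseteq> X" "set ys \<subseteq> X" for xs ys
    proof -
      have "set (map f ys) \<subseteq> Y" using that f by auto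
      from pair[OF conjI[OF that(1) this]] obtain xs' zs where
        1: "subseq xs' xs" "subseq zs (map f ys)" "length xs \<le> K * length xs'"
          "length ys \<le> K * length zs"
          "(\<forall>x\<in>set xs'. \<forall>y\<in>set zs. R x y) \<or> (\<forall>x\<in>set xs'. \<forall>y\<in>set zs. \<not> R x y)"
        by auto
      from subseq_index_list[OF 1(2)] obtain "is" where
        "is": "sorted_wrt (<) is" "set is \<subseteq> {..<length ys}" "zs = map ((!) (map f ys)) is" by auto
      have "zs = map f (map ((!) ys) is)" using "is"(2,3) by auto
      then show ?thesis using 1 map_nth_is_subseq[OF "is"(1,2)]
        by (intro exI[of _ xs'] exI[of _ "map ((!) ys) is"]) auto
    qed
    obtain q where q: "2 ^ q < n" "n \<le> 2 ^ (q + 1)"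
      using ex_power_ivl2[of 2 n] n by auto
    define t where "t = 2 * (q + 1)"
    have t: "(2::nat) ^ t = (2 ^ (q+1))^2" unfolding t_def by (simp add: power_mult[symmetric] mult.commute)
    have "(2::nat) ^ (q + 1) \<le> n ^ 2"
    proof -
      have "(2::nat) ^ (q + 1) \<le> 2 * n" using q(1) by simp
      also have "\<dots> \<le> n ^ 2" using n by (simp add: power2_eq_square)
      finally show ?thesis .
    qed
    then have "(2::nat) ^ t \<le> (n ^ 2) ^ 2" unfolding t by (rule power_mono) simp
    then have t4: "(2::nat) ^ t \<le> n ^ 4" by (simp add: power_mult[symmetric])
    have "2 * K \<le> 2 ^ (2 * K)" using less_exp[of "2 * K"] by simp
    then have "(2 * K) ^ t \<le> (2 ^ (2 * K)) ^ t" by (rule power_mono) simp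
    also have "\<dots> = (2 ^ t) ^ (2 * K)" by (simp add: power_mult[symmetric] mult.commute)
    also have "\<dots> \<le> (n ^ 4) ^ (2 * K)" using t4 by (rule power_mono) simp
    also have "\<dots> = n ^ c" unfolding c_def by (simp add: power_mult[symmetric])
    finally have "(2 * K) ^ t \<le> length s" using s(2) by linarith
    from clique_times_anticlique[OF K pair' s(1) this]
    obtain a b where ab: "subseq a s" "subseq b s" "sorted_wrt (\<lambda>x y. R x (f y)) a"
      "sorted_wrt (\<lambda>x y. \<not> R x (f y)) b" "2 ^ t \<le> length a * length b" by blast
    have "n * n \<le> length a * length b"
    proof -
      have "n ^ 2 \<le> (2 ^ (q + 1)) ^ 2" using q(2) by (rule power_mono) simp
      then show ?thesis using ab(5) t by (simp add: power2_eq_square)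
    qed
    then have "n \<le> length a \<or> n \<le> length b"
      by (meson mult_strict_mono' not_le zero_le)
    then show ?thesis
    proof
      assume "n \<le> length a"
      then show ?thesis using ab subseq_takeI sorted_wrt_take
        by (intro exI[of _ "take n a"]) auto
    next
      assume "n \<le> length b"
      then show ?thesis using ab subseq_takeI sorted_wrt_take
        by (intro exI[of _ "take n b"]) auto
    qed
  qed
  moreover have "c > 0" using K unfolding c_def by simp
  ultimately show ?thesis by blast
qed

section \<open>Reducing the arity\<close>

lemma few_types:
  assumes cells: "distal_cells X Y m T R" and B: "finite B" "B \<subseteq> Y" and xs: "set xs \<subseteq> X"
  shows "\<exists>xs'. subseq xs' xs \<and> length xs \<le> (2 + card B ^ m) * length xs' \<and>
    (\<forall>b\<in>B. \<forall>x\<in>set xs'. \<forall>y\<in>set xs'. R x b = R y b)"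
proof (cases "xs = []")
  case False
  have enough: ?thesis if "finite C" "h ` X \<subseteq> C" "card C \<le> 2 + card B ^ m"
    and same: "\<And>x y b. x \<in> X \<Longrightarrow> y \<in> X \<Longrightarrow> b \<in> B \<Longrightarrow> h x = h y \<Longrightarrow> R x b = R y b"
    for C :: "'c set" and h
  proof -
    have "h ` set xs \<subseteq> C" using that(2) xs by blast
    from pigeonhole_list[OF that(1) this False] obtain c where
      c: "length xs \<le> card C * length (filter (\<lambda>x. h x = c) xs)" by blast
    then have "length xs \<le> (2 + card B ^ m) * length (filter (\<lambda>x. h x = c) xs)"
      using that(3) by (meson le_trans mult_le_mono1)
    then show ?thesis using same xs by (intro exI[of _ "filter (\<lambda>x. h x = c) xs"]) auto
  qed
  show ?thesis
    \<comment> \<open>A cell determines the type, and at most \<open>card B ^ m\<close> cells occur. With at most one parameter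
      there are at most two types; the summand \<open>2\<close> is for this case.\<close>
  proof (cases "card B \<ge> 2")
    case True
    have "\<exists>bs. length bs = m \<and> set bs \<subseteq> B \<and> a \<in> T bs \<and>
        (\<forall>b\<in>B. (\<forall>x\<in>T bs. R x b) \<or> (\<forall>x\<in>T bs. \<not> R x b))" if a: "a \<in> X" for a
      by (rule distal_cellsD[OF cells B True a])
    then obtain h where h: "\<And>a. a \<in> X \<Longrightarrow> length (h a) = m \<and> set (h a) \<subseteq> B \<and> a \<in> T (h a) \<and>
        (\<forall>b\<in>B. (\<forall>x\<in>T (h a). R x b) \<or> (\<forall>x\<in>T (h a). \<not> R x b))" by metis
    show ?thesis
    proof (rule enough[of "{bs. set bs \<subseteq> B \<and> length bs = m}" h])
      show "card {bs. set bs \<subseteq> B \<and> length bs = m} \<le> 2 + card B ^ m"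
        using B by (simp add: card_lists_length_eq)
      show "R x b = R y b" if "x \<in> X" "y \<in> X" "b \<in> B" "h x = h y" for x y b
        using h[OF that(1)] h[OF that(2)] that(3,4) by metis
    qed (use h B finite_lists_length_eq in auto)
  next
    case False
    then have "card B = 0 \<or> card B = 1" by linarith
    then obtain b0 where b0: "B \<subseteq> {b0}"
      using B(1) by (metis card_0_eq card_1_singletonE empty_subsetI subset_refl)
    show ?thesis
    proof (rule enough[of "UNIV :: bool set" "\<lambda>x. R x b0"])
      show "R x b = R y b" if "b \<in> B" "R x b0 = R y b0" for x y b
        using that b0 by auto
    qed auto
  qed
qed (auto intro!: exI[of _ "[]"])

text \<open>The Erdos--Rado argument. It yields a sequence \<open>t\<close> that is
  end-homogeneous: \<open>E (u @ [x])\<close> does not depend on \<open>x\<close>, as long as \<open>x\<close> comes after \<open>u\<close> in \<open>t\<close>. Repeatedly move the first remaining element to the chosen ones \<open>pre\<close> and keep only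
  remaining elements of one type over all chosen elements. Each of the \<open>l\<close> steps costs one element and a
  factor \<open>D\<close>, for which \<open>Suc D ^ l\<close> elements suffice.\<close>

lemma end_homogeneous_subsequence:
  fixes E :: "'x list \<Rightarrow> bool"
  assumes D: "D > 0"
    and refine: "\<And>C xs. C \<subseteq> X \<Longrightarrow> finite C \<Longrightarrow> card C \<le> w \<Longrightarrow> set xs \<subseteq> X \<Longrightarrow>
      \<exists>xs'. subseq xs' xs \<and> length xs \<le> D * length xs' \<and>
        (\<forall>u x y. set u \<subseteq> C \<and> length u = k \<and> x \<in> set xs' \<and> y \<in> set xs' \<longrightarrow> E (u @ [x]) = E (u @ [y]))"
    and pre: "set pre \<subseteq> X" "length pre + l \<le> w"
    and rest: "set rest \<subseteq> X" "length rest \<ge> (Suc D) ^ l"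
    and hom: "\<And>u x y. set u \<subseteq> set pre \<Longrightarrow> length u = k \<Longrightarrow> x \<in> set rest \<Longrightarrow> y \<in> set rest \<Longrightarrow>
      E (u @ [x]) = E (u @ [y])"
  shows "\<exists>t. subseq t rest \<and> length t = l \<and> (\<forall>p q u x y. t = p @ q \<and> set u \<subseteq> set (pre @ p) \<and>
    length u = k \<and> x \<in> set q \<and> y \<in> set q \<longrightarrow> E (u @ [x]) = E (u @ [y]))"
  using pre rest hom
proof (induction l arbitrary: pre rest)
  case 0
  then show ?case by (intro exI[of _ "[]"]) auto
next
  case (Suc l)
  have "rest \<noteq> []" using Suc.prems(4) by auto
  then obtain a r where r: "rest = a # r" by (cases rest) auto
  have aX: "set (pre @ [a]) \<subseteq> X" and rX: "set r \<subseteq> X" using Suc.prems(1,3) r by auto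
  have "card (set (pre @ [a])) \<le> w"
    using card_length[of "pre @ [a]"] Suc.prems(2) by simp
  from refine[OF aX _ this rX] obtain r' where r': "subseq r' r" "length r \<le> D * length r'"
    and hom': "\<And>u x y. set u \<subseteq> set (pre @ [a]) \<Longrightarrow> length u = k \<Longrightarrow> x \<in> set r' \<Longrightarrow> y \<in> set r' \<Longrightarrow>
      E (u @ [x]) = E (u @ [y])" by (metis List.finite_set)
  have "D * Suc D ^ l + 1 \<le> Suc D ^ Suc l" by (simp add: Suc_le_eq)
  also have "\<dots> \<le> D * length r' + 1" using Suc.prems(4) r r'(2) by simp
  finally have "Suc D ^ l \<le> length r'" using D by simp
  moreover have "set r' \<subseteq> X" using r'(1) rX by (auto dest!: subseq_set_subset)
  ultimately have "\<exists>t. subseq t r' \<and> length t = l \<and> (\<forall>p q u x y. t = p @ q \<and>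
      set u \<subseteq> set ((pre @ [a]) @ p) \<and> length u = k \<and> x \<in> set q \<and> y \<in> set q \<longrightarrow>
      E (u @ [x]) = E (u @ [y]))"
    using Suc.prems(2) by (intro Suc.IH aX hom') simp_all
  then obtain t where t: "subseq t r'" "length t = l"
    "\<And>p q u x y. t = p @ q \<Longrightarrow> set u \<subseteq> set ((pre @ [a]) @ p) \<Longrightarrow>
      length u = k \<Longrightarrow> x \<in> set q \<Longrightarrow> y \<in> set q \<Longrightarrow> E (u @ [x]) = E (u @ [y])"
    by blast
  have sub: "subseq (a # t) rest"
    using t(1) r'(1) unfolding r by (auto intro: subseq_order.trans)
  have "E (u @ [x]) = E (u @ [y])"
    if "a # t = p @ q" "set u \<subseteq> set (pre @ p)" "length u = k" "x \<in> set q" "y \<in> set q" for p q u x y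
  proof (cases p)
    case Nil
    then have "x \<in> set rest" "y \<in> set rest" using that sub by (auto dest!: subseq_set_subset)
    then show ?thesis using that Nil by (intro Suc.prems(5)) auto
  next
    case (Cons a' p')
    then show ?thesis using that by (intro t(3)[of p' q]) auto
  qed
  then show ?case using sub t(2) by (intro exI[of _ "a # t"]) auto
qed

text \<open>In an end-homogeneous sequence the last argument of \<open>E\<close> may be replaced by the final element \<open>z\<close>, which
  leaves a relation with one argument less on the elements before \<open>z\<close>.\<close>

lemma indiscernible_from_end_homogeneous:
  fixes E :: "'x list \<Rightarrow> bool"
  assumes hom: "\<And>p q u x y. t @ [z] = p @ q \<Longrightarrow> set u \<subseteq> set p \<Longrightarrow> length u = k \<Longrightarrow>
      x \<in> set q \<Longrightarrow> y \<in> set q \<Longrightarrow> E (u @ [x]) = E (u @ [y])"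
    and v: "subseq v t" "indiscernible k (\<lambda>u. E (u @ [z])) v"
  shows "indiscernible (Suc k) E v"
proof -
  have "\<exists>u'. subseq u' v \<and> length u' = k \<and> E u = E (u' @ [z])"
    if u: "subseq u v" "length u = Suc k" for u
  proof -
    obtain u' x where u': "u = u' @ [x]" "length u' = k"
      using u(2) by (metis length_Suc_conv_rev)
    have "subseq (u' @ [x]) t" using u(1) v(1) u' by (metis subseq_order.trans)
    then obtain p q where pq: "t = p @ q" "subseq u' p" "subseq [x] q"
      using list_emb_appendD by metis
    have "E (u' @ [x]) = E (u' @ [z])"
    proof (rule hom[of p "q @ [z]"])
      show "set u' \<subseteq> set p" using pq(2) by (auto dest!: subseq_set_subset)
      show "x \<in> set (q @ [z])" using pq(3) by (simp add: subseq_singleton_left)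
    qed (use pq u' in auto)
    moreover have "subseq u' v" using u(1) u' by (meson subseq_order.trans prefix_imp_subseq prefixI)
    ultimately show ?thesis using u' by blast
  qed
  then show ?thesis using v(2) unfolding indiscernible_iff by metis
qed

text \<open>The form of the previous lemma for a \<open>(k + 1)\<close>-ary relation \<open>E\<close>: here \<open>R\<close> is \<open>E\<close> with its last argument in
  front, and \<open>g\<close> makes a parameter of the first \<open>k\<close> arguments.\<close>

lemma few_end_types:
  fixes E :: "'x list \<Rightarrow> bool"
  assumes cells: "distal_cells X Y m T R"
    and g: "\<And>u. set u \<subseteq> X \<Longrightarrow> length u = k \<Longrightarrow> g u \<in> Y"
    and E: "\<And>u x. set u \<subseteq> X \<Longrightarrow> length u = k \<Longrightarrow> x \<in> X \<Longrightarrow> E (u @ [x]) = R x (g u)"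
    and C: "C \<subseteq> X" "finite C" "card C \<le> w" and xs: "set xs \<subseteq> X"
  shows "\<exists>xs'. subseq xs' xs \<and> length xs \<le> (2 + (w ^ k) ^ m) * length xs' \<and>
    (\<forall>u x y. set u \<subseteq> C \<and> length u = k \<and> x \<in> set xs' \<and> y \<in> set xs' \<longrightarrow> E (u @ [x]) = E (u @ [y]))"
proof -
  define U where "U = {u. set u \<subseteq> C \<and> length u = k}"
  have U: "finite U" "card U \<le> w ^ k"
    using finite_lists_length_eq[OF C(2)] card_lists_length_eq[OF C(2)] C(3)
    by (auto simp: U_def power_mono)
  have "g ` U \<subseteq> Y" using g C(1) unfolding U_def by blast
  from few_types[OF cells _ this xs] U obtain xs' where xs':
    "subseq xs' xs" "length xs \<le> (2 + card (g ` U) ^ m) * length xs'"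
    "\<forall>b\<in>g ` U. \<forall>x\<in>set xs'. \<forall>y\<in>set xs'. R x b = R y b" by blast
  have "card (g ` U) \<le> w ^ k" using U card_image_le le_trans by blast
  then have "2 + card (g ` U) ^ m \<le> 2 + (w ^ k) ^ m" by (simp add: power_mono)
  then have len: "length xs \<le> (2 + (w ^ k) ^ m) * length xs'"
    using xs'(2) by (meson le_trans mult_le_mono1)
  have "E (u @ [x]) = E (u @ [y])"
    if u: "set u \<subseteq> C" "length u = k" and xy: "x \<in> set xs'" "y \<in> set xs'" for u x y
  proof -
    have uX: "set u \<subseteq> X" using u(1) C(1) by (rule subset_trans)
    have "u \<in> U" using u by (simp add: U_def)
    then have "R x (g u) = R y (g u)" using xs'(3) xy by blast
    moreover have "x \<in> X" "y \<in> X" using xy subseq_set_subset[OF xs'(1)] xs by auto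
    ultimately show ?thesis using E[OF uX u(2)] by simp
  qed
  then show ?thesis using xs'(1) len by (intro exI[of _ xs']) simp
qed

section \<open>Tower estimates\<close>

lemma twr_ge_arg: "n \<le> twr (Suc i) n"
proof (induction i)
  case (Suc i)
  have "twr (Suc i) n < 2 ^ twr (Suc i) n" by (rule less_exp)
  with Suc.IH have "n \<le> 2 ^ twr (Suc i) n" by linarith
  then show ?case by simp
qed simp

text \<open>A polynomial in the value of a tower is absorbed by enlarging the exponent at its top: one
  exponential further up, a power of the value is only a multiple of the exponent, and \<open>4 * y \<le> y ^ 4\<close>.\<close>

lemma twr_power4:
  assumes "a \<ge> 2"
  shows "twr (Suc i) a ^ 4 \<le> twr (Suc i) (a ^ 4)"
proof (induction i)
  case (Suc i)
  define y where "y = twr (Suc i) a"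
  have "y \<ge> 2" unfolding y_def using twr_ge_arg[of a i] assms by linarith
  then have "(2::nat) ^ 3 \<le> y ^ 3" by (intro power_mono) auto
  then have "y * 4 \<le> y * y ^ 3" by (intro mult_le_mono2) simp
  also have "y * y ^ 3 = y ^ 4" by (simp add: power_eq_if)
  also have "y ^ 4 \<le> twr (Suc i) (a ^ 4)" using Suc unfolding y_def .
  finally have "(2::nat) ^ (y * 4) \<le> 2 ^ twr (Suc i) (a ^ 4)" by (rule power_increasing) simp
  then show ?case unfolding y_def by (simp add: power_mult)
qed simp

text \<open>The left-hand side is the length that the Erdos--Rado argument needs to produce \<open>y + 1\<close> elements if there are
  at most \<open>2 + (card C ^ k) ^ m\<close> types over a set \<open>C\<close> of at most \<open>y + 1\<close> elements.\<close>

lemma step_bound: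
  fixes y :: nat
  assumes "y \<ge> k * m + 4"
  shows "Suc (2 + ((y + 1) ^ k) ^ m) ^ (y + 1) \<le> 2 ^ (y ^ 4)"
proof -
  have "y + 1 \<le> 2 ^ (y + 1)" using less_exp[of "y + 1"] by simp
  then have "(y + 1) ^ (k * m) \<le> (2 ^ (y + 1)) ^ (k * m)" by (rule power_mono) simp
  then have "((y + 1) ^ k) ^ m \<le> 2 ^ ((y + 1) * (k * m))" by (simp only: power_mult[symmetric])
  moreover have "(1::nat) \<le> 2 ^ ((y + 1) * (k * m))" by simp
  ultimately have "Suc (2 + ((y + 1) ^ k) ^ m) \<le> 4 * 2 ^ ((y + 1) * (k * m))" by linarith
  also have "\<dots> = 2 ^ (2 + (y + 1) * (k * m))" by (simp add: power_add)
  finally have "Suc (2 + ((y + 1) ^ k) ^ m) ^ (y + 1) \<le> (2 ^ (2 + (y + 1) * (k * m))) ^ (y + 1)"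
    by (rule power_mono) simp
  also have "\<dots> = 2 ^ ((2 + (y + 1) * (k * m)) * (y + 1))" by (simp only: power_mult[symmetric])
  also have "\<dots> \<le> 2 ^ (y ^ 4)"
  proof (rule power_increasing)
    have y: "y + 1 \<le> 2 * y" using assms by simp
    have "2 + (y + 1) * (k * m) \<le> 2 * y + 2 * y * (k * m)"
      using y mult_le_mono1[OF y, of "k * m"] by linarith
    also have "\<dots> = 2 * y * (1 + k * m)" by (simp add: algebra_simps)
    also have "\<dots> \<le> 2 * y * y" using assms by (intro mult_le_mono2) simp
    finally have "(2 + (y + 1) * (k * m)) * (y + 1) \<le> (2 * y * y) * (2 * y)"
      using y by (rule mult_le_mono)
    also have "\<dots> = 4 * (y * y * y)" by simp
    also have "\<dots> \<le> y * (y * y * y)" using assms by (intro mult_le_mono1) simp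
    also have "\<dots> = y ^ 4" by (simp add: power_eq_if)
    finally show "(2 + (y + 1) * (k * m)) * (y + 1) \<le> y ^ 4" .
  qed simp
  finally show ?thesis .
qed

section \<open>Renaming variables and passing to reducts\<close>

fun lift_var :: "(nat \<Rightarrow> nat) \<Rightarrow> nat \<Rightarrow> nat" where
  "lift_var f 0 = 0"
| "lift_var f (Suc i) = Suc (f i)"

fun rename_tm :: "(nat \<Rightarrow> nat) \<Rightarrow> 'f tm \<Rightarrow> 'f tm" where
  "rename_tm f (Var i) = Var (f i)"
| "rename_tm f (App g ts) = App g (map (rename_tm f) ts)"

fun rename_fm :: "(nat \<Rightarrow> nat) \<Rightarrow> ('f, 'r) fm \<Rightarrow> ('f, 'r) fm" where
  "rename_fm f (Eq s t) = Eq (rename_tm f s) (rename_tm f t)"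
| "rename_fm f (Rel r ts) = Rel r (map (rename_tm f) ts)"
| "rename_fm f (Neg \<phi>) = Neg (rename_fm f \<phi>)"
| "rename_fm f (Conj \<phi> \<psi>) = Conj (rename_fm f \<phi>) (rename_fm f \<psi>)"
| "rename_fm f (Ex \<phi>) = Ex (rename_fm (lift_var f) \<phi>)"

lemma is_term_rename:
  assumes "is_term L n t" "\<And>i. i < n \<Longrightarrow> f i < n'"
  shows "is_term L n' (rename_tm f t)"
  using assms by (induction t) auto

lemma val_rename:
  assumes "is_term L n t" "\<And>i. i < n \<Longrightarrow> bs ! f i = as ! i"
  shows "val M bs (rename_tm f t) = val M as t"
  using assms(1)
proof (induction t)
  case (App g ts)
  then have "map (val M bs) (map (rename_tm f) ts) = map (val M as) ts" by simp
  then show ?case by (simp only: rename_tm.simps val.simps)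
qed (use assms(2) in simp)

lemma formula_rename:
  assumes "formula L n \<phi>" "\<And>i. i < n \<Longrightarrow> f i < n'"
  shows "formula L n' (rename_fm f \<phi>)"
  using assms
proof (induction \<phi> arbitrary: n n' f)
  case (Eq s t)
  then show ?case using is_term_rename[of L n _ f n'] by simp
next
  case (Rel r ts)
  then show ?case using is_term_rename[of L n _ f n'] by simp
next
  case (Ex \<phi>)
  have "lift_var f i < Suc n'" if "i < Suc n" for i using Ex.prems(2) that by (cases i) auto
  then show ?case using Ex.IH[of "Suc n" "lift_var f" "Suc n'"] Ex.prems(1) by simp
qed auto

lemma sat_rename:
  assumes "formula L n \<phi>" "\<And>i. i < n \<Longrightarrow> bs ! f i = as ! i"
  shows "sat M bs (rename_fm f \<phi>) = sat M as \<phi>"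
  using assms
proof (induction \<phi> arbitrary: n f as bs)
  case (Eq s t)
  then show ?case using val_rename[of L n _ bs f as M] by simp
next
  case (Rel r ts)
  then have "map (val M bs) (map (rename_tm f) ts) = map (val M as) ts"
    using val_rename[of L n _ bs f as M] by simp
  then show ?case by (simp only: rename_fm.simps sat.simps)
next
  case (Ex \<phi>)
  have "sat M (x # bs) (rename_fm (lift_var f) \<phi>) = sat M (x # as) \<phi>" for x
  proof (rule Ex.IH)
    show "formula L (Suc n) \<phi>" using Ex.prems(1) by simp
    show "(x # bs) ! lift_var f i = (x # as) ! i" if "i < Suc n" for i
      using Ex.prems(2) that by (cases i) auto
  qed
  then show ?case by simp
next
  case (Conj \<phi> \<psi>)
  then show ?case by (metis formula.simps(4) rename_fm.simps(4) sat.simps(4))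
next
  case (Neg \<phi>)
  then show ?case by (metis formula.simps(3) rename_fm.simps(3) sat.simps(3))
qed

text \<open>Distality describes the sets that a formula defines in its first variables, whereas the Erdos--Rado
  argument needs types in the last of the variables \<open>x\<^sub>1, x\<^sub>2, \<dots>\<close>; this moves a block of variables to the front.\<close>

lemma swap_variable_blocks:
  assumes "formula L (p + q + e) \<phi>"
  obtains \<phi>' where "formula L (q + p + e) \<phi>'"
    "\<And>M u x b. length u = p \<Longrightarrow> length x = q \<Longrightarrow> sat M (x @ u @ b) \<phi>' = sat M (u @ x @ b) \<phi>"
proof -
  define f where "f i = (if i < p then q + i else if i < p + q then i - p else i)" for i
  have "formula L (q + p + e) (rename_fm f \<phi>)"
    using assms by (rule formula_rename) (auto simp: f_def)
  moreover have "sat M (x @ u @ b) (rename_fm f \<phi>) = sat M (u @ x @ b) \<phi>"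
    if "length u = p" "length x = q" for M u x b
    using assms by (rule sat_rename) (use that in \<open>auto simp: f_def nth_append add.commute\<close>)
  ultimately show ?thesis using that by blast
qed

lemma val_reduct:
  assumes "reduct L M L' N" "is_term L n t" "as \<in> tuples M n"
  shows "val M as t \<in> univ M \<and> val N as t = val M as t"
  using assms(2)
proof (induction t)
  case (Var i)
  then show ?case using assms(3) by (auto simp: tuples_def)
next
  case (App g ts)
  then have "map (val M as) ts \<in> tuples M (length ts)" by (auto simp: tuples_def)
  moreover have "map (val N as) ts = map (val M as) ts" using App by simp
  moreover have "funs L g = Some (length ts)" using App.prems by simp
  ultimately show ?case using assms(1)
    unfolding reduct_def is_struct_def val.simps by metis
qed

lemma sat_reduct:
  assumes "reduct L M L' N" "formula L n \<phi>" "as \<in> tuples M n"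
  shows "sat N as \<phi> = sat M as \<phi>"
  using assms(2,3)
proof (induction \<phi> arbitrary: n as)
  case (Eq s t)
  then show ?case using val_reduct[OF assms(1), of n] by simp
next
  case (Rel r ts)
  then have vals: "\<And>t. t \<in> set ts \<Longrightarrow> val M as t \<in> univ M \<and> val N as t = val M as t"
    using val_reduct[OF assms(1)] by auto
  then have "map (val M as) ts \<in> tuples M (length ts)" by (auto simp: tuples_def)
  moreover have "map (val N as) ts = map (val M as) ts" using vals by simp
  moreover have "rels L r = Some (length ts)" using Rel.prems by simp
  ultimately show ?case using assms(1) unfolding reduct_def sat.simps by metis
next
  case (Ex \<phi>)
  have "sat N (x # as) \<phi> = sat M (x # as) \<phi>" if "x \<in> univ M" for x
    using Ex.prems that by (intro Ex.IH[of "Suc n"]) (auto simp: tuples_def)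
  moreover have "univ M = univ N" using assms(1) by (simp add: reduct_def)
  ultimately show ?case by auto
next
  case (Neg \<phi>)
  then show ?case by (metis formula.simps(3) sat.simps(3))
next
  case (Conj \<phi> \<psi>)
  then show ?case by (metis formula.simps(4) sat.simps(4))
qed

lemma is_term_sublanguage: "funs L \<subseteq>\<^sub>m funs L' \<Longrightarrow> is_term L n t \<Longrightarrow> is_term L' n t"
  by (induction t) (auto simp: map_le_def dom_def)

lemma formula_sublanguage:
  assumes "funs L \<subseteq>\<^sub>m funs L'" "rels L \<subseteq>\<^sub>m rels L'" "formula L n \<phi>"
  shows "formula L' n \<phi>"
  using assms(3)
proof (induction \<phi> arbitrary: n)
  case (Rel r ts)
  then have "rels L' r = Some (length ts)" using assms(2) by (auto simp: map_le_def dom_def)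
  then show ?case using Rel is_term_sublanguage[OF assms(1)] by simp
qed (use is_term_sublanguage[OF assms(1)] in auto)

section \<open>Tower bounds in distal structures\<close>

lemma distal_imp_cells:
  assumes "distal L N" "formula L (p + q) \<phi>"
  obtains m T where "distal_cells (tuples N p) (tuples N q) m T (\<lambda>x y. sat N (x @ y) \<phi>)"
proof -
  obtain m \<theta> where \<theta>: "\<And>B a. finite B \<and> B \<subseteq> tuples N q \<and> card B \<ge> 2 \<Longrightarrow> a \<in> tuples N p \<Longrightarrow>
      \<exists>bs. length bs = m \<and> set bs \<subseteq> B \<and> sat N (a @ concat bs) \<theta> \<and>
        (\<forall>b \<in> B. defset N p \<theta> (concat bs) \<subseteq> defset N p \<phi> b \<or>
          defset N p \<phi> b \<inter> defset N p \<theta> (concat bs) = {})"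
    using assms unfolding distal_def by metis
  have "distal_cells (tuples N p) (tuples N q) m (\<lambda>bs. defset N p \<theta> (concat bs))
      (\<lambda>x y. sat N (x @ y) \<phi>)"
    unfolding distal_cells_def
  proof (intro allI impI ballI)
    fix B a assume B: "finite B \<and> B \<subseteq> tuples N q \<and> card B \<ge> 2" and a: "a \<in> tuples N p"
    obtain bs where bs: "length bs = m" "set bs \<subseteq> B" "sat N (a @ concat bs) \<theta>"
      "\<And>b. b \<in> B \<Longrightarrow> defset N p \<theta> (concat bs) \<subseteq> defset N p \<phi> b \<or>
          defset N p \<phi> b \<inter> defset N p \<theta> (concat bs) = {}"
      using \<theta>[OF B a] by blast
    let ?T = "defset N p \<theta> (concat bs)"
    have "(\<forall>x\<in>?T. sat N (x @ b) \<phi>) \<or> (\<forall>x\<in>?T. \<not> sat N (x @ b) \<phi>)" if "b \<in> B" for b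
      using bs(4)[OF that] unfolding defset_def by blast
    moreover have "a \<in> ?T" using a bs(3) by (simp add: defset_def)
    ultimately show "\<exists>bs. length bs = m \<and> set bs \<subseteq> B \<and> a \<in> defset N p \<theta> (concat bs) \<and>
        (\<forall>b\<in>B. (\<forall>x\<in>defset N p \<theta> (concat bs). sat N (x @ b) \<phi>) \<or>
          (\<forall>x\<in>defset N p \<theta> (concat bs). \<not> sat N (x @ b) \<phi>))"
      using bs(1,2) by blast
  qed
  then show ?thesis using that by blast
qed

lemma append_tuples: "a \<in> tuples N p \<Longrightarrow> b \<in> tuples N q \<Longrightarrow> a @ b \<in> tuples N (p + q)"
  by (auto simp: tuples_def)

lemma concat_tuples: "set u \<subseteq> tuples N d \<Longrightarrow> concat u \<in> tuples N (length u * d)"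
  by (induction u) (auto simp: tuples_def)

text \<open>Induction on the arity \<open>i + 2\<close> with the parameter length \<open>e\<close> arbitrary: the final element of the
  end-homogeneous sequence becomes an additional parameter of the same formula, so \<open>e\<close> grows by \<open>d\<close>.\<close>

lemma distal_tower_ramsey:
  assumes "distal L N" "formula L (Suc (Suc i) * d + e) \<phi>"
  shows "\<exists>c>0. \<exists>n0. \<forall>n\<ge>n0. \<forall>b\<in>tuples N e. \<forall>s. set s \<subseteq> tuples N d \<and> length s \<ge> twr (Suc i) (n ^ c) \<longrightarrow>
    (\<exists>t. subseq t s \<and> length t = n \<and> indiscernible (Suc (Suc i)) (def_rel N \<phi> b) t)"
  using assms(2)
proof (induction i arbitrary: e)
  case 0
  then have "formula L (d + (d + e)) \<phi>" by (simp add: add.assoc)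
  then obtain m T where "distal_cells (tuples N d) (tuples N (d + e)) m T (\<lambda>x y. sat N (x @ y) \<phi>)"
    using distal_imp_cells[OF assms(1)] by blast
  from polynomial_ramsey_binary[OF this] obtain c where
    c: "c > 0 \<and> (\<forall>n\<ge>2. \<forall>f s. f ` tuples N d \<subseteq> tuples N (d + e) \<and> set s \<subseteq> tuples N d \<and>
      length s \<ge> n ^ c \<longrightarrow> (\<exists>t. subseq t s \<and> length t = n \<and>
        (sorted_wrt (\<lambda>x y. sat N (x @ f y) \<phi>) t \<or> sorted_wrt (\<lambda>x y. \<not> sat N (x @ f y) \<phi>) t)))" ..
  have "\<exists>t. subseq t s \<and> length t = n \<and> indiscernible 2 (def_rel N \<phi> b) t"
    if "n \<ge> 2" "b \<in> tuples N e" "set s \<subseteq> tuples N d" "length s \<ge> n ^ c" for n b s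
  proof -
    have "(\<lambda>y. y @ b) ` tuples N d \<subseteq> tuples N (d + e)" using that(2) append_tuples by blast
    then have "\<exists>t. subseq t s \<and> length t = n \<and>
        (sorted_wrt (\<lambda>x y. sat N (x @ y @ b) \<phi>) t \<or> sorted_wrt (\<lambda>x y. \<not> sat N (x @ y @ b) \<phi>) t)"
      by (intro c[THEN conjunct2, rule_format, of n "\<lambda>y. y @ b" s] conjI that(1,3,4))
    then obtain t where t: "subseq t s" "length t = n"
      "sorted_wrt (\<lambda>x y. sat N (x @ y @ b) \<phi>) t \<or> sorted_wrt (\<lambda>x y. \<not> sat N (x @ y @ b) \<phi>) t"
      by blast
    from t(3) have "indiscernible 2 (def_rel N \<phi> b) t"
      using indiscernible_pairs[of "def_rel N \<phi> b" True] indiscernible_pairs[of "def_rel N \<phi> b" False]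
      by (auto simp: def_rel_def)
    with t show ?thesis by blast
  qed
  then show ?case using c by (intro exI[of _ c] conjI exI[of _ 2]) (auto simp: numeral_2_eq_2)
next
  case (Suc i)
  define k where "k = Suc (Suc i)"
  have "formula L (k * d + (d + e)) \<phi>"
    using Suc.prems by (simp add: k_def algebra_simps)
  from Suc.IH[of "d + e", folded k_def, OF this] obtain c n0 where c: "c > 0" and
    IH: "\<And>n b s. n \<ge> n0 \<Longrightarrow> b \<in> tuples N (d + e) \<Longrightarrow> set s \<subseteq> tuples N d \<Longrightarrow>
      length s \<ge> twr (Suc i) (n ^ c) \<Longrightarrow>
      \<exists>t. subseq t s \<and> length t = n \<and> indiscernible k (def_rel N \<phi> b) t"
    by blast
  have "formula L (k * d + d + e) \<phi>"
    using Suc.prems by (simp add: k_def algebra_simps)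
  then obtain \<phi>' where \<phi>': "formula L (d + k * d + e) \<phi>'"
    "\<And>u x b. length u = k * d \<Longrightarrow> length x = d \<Longrightarrow> sat N (x @ u @ b) \<phi>' = sat N (u @ x @ b) \<phi>"
    by (metis swap_variable_blocks)
  have "formula L (d + (k * d + e)) \<phi>'" using \<phi>'(1) by (simp add: add.assoc)
  then obtain m T where
    cells: "distal_cells (tuples N d) (tuples N (k * d + e)) m T (\<lambda>x y. sat N (x @ y) \<phi>')"
    using distal_imp_cells[OF assms(1)] by blast
  have "\<exists>v. subseq v s \<and> length v = n \<and> indiscernible (Suc k) (def_rel N \<phi> b) v"
    if n: "n \<ge> max n0 (k * m + 4)" and b: "b \<in> tuples N e" and s: "set s \<subseteq> tuples N d"
      "length s \<ge> twr k (n ^ (4 * c))" for n b s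
  proof -
    \<comment> \<open>An end-homogeneous sequence of length \<open>y + 1\<close> is needed: \<open>y\<close> elements for the induction hypothesis
      and the final element \<open>z\<close> as a parameter.\<close>
    define y where "y = twr (Suc i) (n ^ c)"
    define D where "D = 2 + ((y + 1) ^ k) ^ m"
    define E where "E = def_rel N \<phi> b"
    have "n \<le> n ^ c" using n c by (intro self_le_power) auto
    then have nc: "n \<le> y" "2 \<le> n ^ c" using twr_ge_arg[of "n ^ c" i] n unfolding y_def by auto
    have "Suc D ^ (y + 1) \<le> 2 ^ (y ^ 4)"
      unfolding D_def using nc(1) n by (intro step_bound) simp
    also have "\<dots> \<le> 2 ^ twr (Suc i) (n ^ (4 * c))"
      using twr_power4[OF nc(2), of i] unfolding y_def
      by (intro power_increasing) (simp_all add: power_mult[symmetric] mult.commute)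
    also have "\<dots> \<le> length s" using s(2) by (simp add: k_def)
    finally have long: "Suc D ^ (y + 1) \<le> length s" .
    have refine: "\<exists>xs'. subseq xs' xs \<and> length xs \<le> D * length xs' \<and>
        (\<forall>u x y. set u \<subseteq> C \<and> length u = k \<and> x \<in> set xs' \<and> y \<in> set xs' \<longrightarrow> E (u @ [x]) = E (u @ [y]))"
      if "C \<subseteq> tuples N d" "finite C" "card C \<le> y + 1" "set xs \<subseteq> tuples N d" for C xs
      unfolding D_def
    proof (rule few_end_types[OF cells _ _ that])
      fix u assume u: "set u \<subseteq> tuples N d" "length u = k"
      then have cu: "concat u \<in> tuples N (k * d)" using concat_tuples by blast
      then show "concat u @ b \<in> tuples N (k * d + e)" using b by (rule append_tuples)
      fix x assume "x \<in> tuples N d"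
      then show "E (u @ [x]) = sat N (x @ concat u @ b) \<phi>'"
        using cu \<phi>'(2) by (simp add: E_def def_rel_def tuples_def)
    qed
    have "\<exists>t. subseq t s \<and> length t = y + 1 \<and> (\<forall>p q u x y. t = p @ q \<and> set u \<subseteq> set ([] @ p) \<and>
        length u = k \<and> x \<in> set q \<and> y \<in> set q \<longrightarrow> E (u @ [x]) = E (u @ [y]))"
    proof (rule end_homogeneous_subsequence[where D = D and w = "y + 1" and X = "tuples N d"])
      show "D > 0" by (simp add: D_def)
      show "E (u @ [x]) = E (u @ [y])" if "set u \<subseteq> set []" "length u = k" for u x y
        using that by (auto simp: k_def)
    qed (use s(1) long refine in auto)
    then obtain t' where t': "subseq t' s" "length t' = Suc y"
      and hom': "\<And>p q u x y. t' = p @ q \<Longrightarrow> set u \<subseteq> set p \<Longrightarrow> length u = k \<Longrightarrow>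
        x \<in> set q \<Longrightarrow> y \<in> set q \<Longrightarrow> E (u @ [x]) = E (u @ [y])"
      by (metis Suc_eq_plus1 append_Nil)
    obtain t z where tz: "t' = t @ [z]" "length t = y" using t'(2) by (metis length_Suc_conv_rev)
    have mem: "set t' \<subseteq> tuples N d" using t'(1) s(1) by (auto dest!: subseq_set_subset)
    then have "z @ b \<in> tuples N (d + e)" using b tz(1) by (intro append_tuples) auto
    then obtain v where v: "subseq v t" "length v = n" "indiscernible k (def_rel N \<phi> (z @ b)) v"
      using IH[of n "z @ b" t] n mem tz unfolding y_def by auto
    have "def_rel N \<phi> (z @ b) = (\<lambda>u. E (u @ [z]))" by (simp add: E_def def_rel_def fun_eq_iff)
    then have v': "indiscernible k (\<lambda>u. E (u @ [z])) v" using v(3) by simp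
    have "indiscernible (Suc k) E v"
    proof (rule indiscernible_from_end_homogeneous[OF _ v(1) v'])
      show "E (u @ [x]) = E (u @ [y])" if "t @ [z] = p @ q" "set u \<subseteq> set p" "length u = k"
        "x \<in> set q" "y \<in> set q" for p q u x y
        by (rule hom'[OF trans[OF tz(1) that(1)] that(2-5)])
    qed
    moreover have "subseq v s"
      using v(1) t'(1) tz(1) by (meson prefixI prefix_imp_subseq subseq_order.trans)
    ultimately show ?thesis using v(2) unfolding E_def by blast
  qed
  then show ?case using c unfolding k_def
    by (intro exI[of _ "4 * c"] conjI exI[of _ "max n0 (k * m + 4)"]) (auto simp: k_def)
qed

text \<open>A formula in the language of \<open>M\<close> is one in the language of the distal structure \<open>N\<close> and defines the same
  relation there, so the bound for \<open>N\<close> carries over to \<open>M\<close>.\<close>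

theorem corollary6p10:
  fixes L L' :: "('f, 'r) fo_lang"
    and M N :: "('a, 'f, 'r) fo_struct"
    and \<phi> :: "('f, 'r) fm"
    and k d e :: nat
  assumes "distal L' N"
    and "reduct L M L' N"
    and "k \<ge> 2"
    and "formula L (k * d + e) \<phi>"
  shows "\<exists>c::nat. \<forall>\<^sub>F n in sequentially. ramsey_star M k d e \<phi> n \<le> twr (k - 1) (n ^ c)"
proof -
  obtain i where k: "k = Suc (Suc i)" using assms(3) by (metis add_2_eq_Suc le_Suc_ex)
  have "formula L' (Suc (Suc i) * d + e) \<phi>"
    using assms(2,4) formula_sublanguage unfolding k reduct_def by metis
  from distal_tower_ramsey[OF assms(1) this] obtain c n0 where
    ramsey: "\<And>n b s. n \<ge> n0 \<Longrightarrow> b \<in> tuples N e \<Longrightarrow> set s \<subseteq> tuples N d \<Longrightarrow>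
      length s \<ge> twr (Suc i) (n ^ c) \<Longrightarrow>
      \<exists>t. subseq t s \<and> length t = n \<and> indiscernible k (def_rel N \<phi> b) t"
    unfolding k by blast
  have tuples_eq: "tuples M j = tuples N j" for j
    using assms(2) by (simp add: tuples_def reduct_def)
  have transfer: "indiscernible k (def_rel M \<phi> b) t"
    if "indiscernible k (def_rel N \<phi> b) t" "set t \<subseteq> tuples M d" "b \<in> tuples M e" for t b
  proof -
    have "def_rel N \<phi> b u = def_rel M \<phi> b u" if u: "subseq u t" "length u = k" for u
    proof -
      have "set u \<subseteq> tuples M d" using subseq_set_subset[OF u(1)] \<open>set t \<subseteq> tuples M d\<close> by (rule subset_trans)
      then have "concat u \<in> tuples M (k * d)" using concat_tuples u(2) by blast
      then have "concat u @ b \<in> tuples M (k * d + e)" using \<open>b \<in> tuples M e\<close> by (rule append_tuples)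
      then show ?thesis unfolding def_rel_def by (rule sat_reduct[OF assms(2,4)])
    qed
    then show ?thesis using that(1) unfolding indiscernible_iff by metis
  qed
  have "ramsey_star M k d e \<phi> n \<le> twr (k - 1) (n ^ c)" if n: "n \<ge> n0" for n
  proof -
    have le: "ramsey_num M k d \<phi> b n \<le> twr (k - 1) (n ^ c)" if b: "b \<in> tuples M e" for b
      unfolding ramsey_num_def
    proof (intro Least_le allI impI)
      fix s assume s: "length s = twr (k - 1) (n ^ c) \<and> set s \<subseteq> tuples M d"
      then obtain t where t: "subseq t s" "length t = n" "indiscernible k (def_rel N \<phi> b) t"
        using ramsey[OF n, of b s] b unfolding tuples_eq k by auto
      moreover have "set t \<subseteq> tuples M d" using subseq_set_subset[OF t(1)] s by auto
      ultimately show "\<exists>t. subseq t s \<and> length t = n \<and> indiscernible k (def_rel M \<phi> b) t"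
        using transfer b by blast
    qed
    \<comment> \<open>The maximum has to be that of a finite nonempty set: finite by \<open>le\<close>, nonempty because \<open>M\<close> is.\<close>
    obtain x where "x \<in> univ M" using assms(2) by (auto simp: reduct_def is_struct_def)
    then have "replicate e x \<in> tuples M e" by (auto simp: tuples_def)
    then have "tuples M e \<noteq> {}" by blast
    moreover have "finite ((\<lambda>b. ramsey_num M k d \<phi> b n) ` tuples M e)"
    proof (rule finite_subset)
      show "(\<lambda>b. ramsey_num M k d \<phi> b n) ` tuples M e \<subseteq> {..twr (k - 1) (n ^ c)}"
        using le by (simp add: image_subset_iff)
    qed simp
    ultimately show ?thesis unfolding ramsey_star_def using le by (simp add: Max_le_iff)
  qed
  then show ?thesis unfolding eventually_sequentially by (intro exI[of _ c] exI[of _ n0]) simp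
qed

end
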